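(* Any axially symmetric slice-open set $\Omega\subset\mathbb{H}$ is a domain of slice regularity.
   Context: $\mathbb{H}$ denotes the quaternions, $\mathbb{S}=\{q\in\mathbb{H}: q^2=-1\}$, $\mathbb{C}_I=\mathbb{R}+I\mathbb{R}$ for $I\in\mathbb{S}$, and $\Omega_I:=\Omega\cap\mathbb{C}_I$. $\Omega$ is axially symmetric if $x+yI\in\Omega$ ($x,y\in\mathbb{R}$, $I\in\mathbb{S}$) implies $x+yL\in\Omega$ for all $L\in\mathbb{S}$. A set $\Omega\subset\mathbb{H}$ is slice-open if $\Omega_I$ is open in $\mathbb{C}_I$ for every $I\in\mathbb{S}$; slice-open sets form the slice topology on $\mathbb{H}$, and slice-connected means connected in this topology. A function $f:\Omega\to\mathbb{H}$ on a slice-open set is slice regular if for every $I\in\mathbb{S}$ the restriction $f|_{\Omega_I}$ has continuous partial derivatives and satisfies $\frac12\left(\frac{\partial}{\partial x}+I\frac{\partial}{\partial y}\right)f(x+yI)=0$ on $\Omega_I$. A slice-open set $\Omega\subset\mathbb{H}$ is a domain of slice regularity if there are no slice-open sets $\Omega_1,\Omega_2$ in $\mathbb{H}$ such that: (i) $\varnothing\neq\Omega_1\subset\Omega_2\cap\Omega$; (ii) $\Omega_2$ is slice-connected and not contained in $\Omega$; (iii) for every slice regular function $f$ on $\Omega$ there is a slice regular function $\widetilde f$ on $\Omega_2$ with $f=\widetilde f$ on $\Omega_1$. *)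

theory Defs
  imports "HOL-Analysis.Analysis"
begin

section \<open>Quaternions\<close>

datatype quat = Quat (qre: real) (qi: real) (qj: real) (qk: real)

lemma quat_eq_iff:
  "p = q \<longleftrightarrow> qre p = qre q \<and> qi p = qi q \<and> qj p = qj q \<and> qk p = qk q"
  by (auto intro: quat.expand)

instantiation quat :: real_vector
begin

definition "0 = Quat 0 0 0 0"
definition "p + q = Quat (qre p + qre q) (qi p + qi q) (qj p + qj q) (qk p + qk q)"
definition "p - q = Quat (qre p - qre q) (qi p - qi q) (qj p - qj q) (qk p - qk q)"
definition "- q = Quat (- qre q) (- qi q) (- qj q) (- qk q)"
definition "r *\<^sub>R q = Quat (r * qre q) (r * qi q) (r * qj q) (r * qk q)"

instance
  by standard
    (simp_all add: quat_eq_iff zero_quat_def plus_quat_def minus_quat_def uminus_quat_def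
      scaleR_quat_def algebra_simps)

end

lemma quat_zero_sel [simp]: "qre 0 = 0" "qi 0 = 0" "qj 0 = 0" "qk 0 = 0"
  by (simp_all add: zero_quat_def)

lemma quat_plus_sel [simp]:
  "qre (p + q) = qre p + qre q" "qi (p + q) = qi p + qi q"
  "qj (p + q) = qj p + qj q" "qk (p + q) = qk p + qk q"
  by (simp_all add: plus_quat_def)

lemma quat_minus_sel [simp]:
  "qre (p - q) = qre p - qre q" "qi (p - q) = qi p - qi q"
  "qj (p - q) = qj p - qj q" "qk (p - q) = qk p - qk q"
  by (simp_all add: minus_quat_def)

lemma quat_uminus_sel [simp]:
  "qre (- q) = - qre q" "qi (- q) = - qi q" "qj (- q) = - qj q" "qk (- q) = - qk q"
  by (simp_all add: uminus_quat_def)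

lemma quat_scaleR_sel [simp]:
  "qre (r *\<^sub>R q) = r * qre q" "qi (r *\<^sub>R q) = r * qi q"
  "qj (r *\<^sub>R q) = r * qj q" "qk (r *\<^sub>R q) = r * qk q"
  by (simp_all add: scaleR_quat_def)

instantiation quat :: real_algebra_1
begin

definition "1 = Quat 1 0 0 0"
definition "p * q = Quat
  (qre p * qre q - qi p * qi q - qj p * qj q - qk p * qk q)
  (qre p * qi q + qi p * qre q + qj p * qk q - qk p * qj q)
  (qre p * qj q - qi p * qk q + qj p * qre q + qk p * qi q)
  (qre p * qk q + qi p * qj q - qj p * qi q + qk p * qre q)"

instance
  by standard
    (simp_all add: quat_eq_iff one_quat_def times_quat_def algebra_simps)

end

lemma quat_one_sel [simp]: "qre 1 = 1" "qi 1 = 0" "qj 1 = 0" "qk 1 = 0"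
  by (simp_all add: one_quat_def)

lemma quat_times_sel [simp]:
  "qre (p * q) = qre p * qre q - qi p * qi q - qj p * qj q - qk p * qk q"
  "qi (p * q) = qre p * qi q + qi p * qre q + qj p * qk q - qk p * qj q"
  "qj (p * q) = qre p * qj q - qi p * qk q + qj p * qre q + qk p * qi q"
  "qk (p * q) = qre p * qk q + qi p * qj q - qj p * qi q + qk p * qre q"
  by (simp_all add: times_quat_def)

instantiation quat :: real_inner
begin

definition "inner p q = qre p * qre q + qi p * qi q + qj p * qj q + qk p * qk q"
definition "norm (q::quat) = sqrt (inner q q)"
definition "sgn (q::quat) = q /\<^sub>R norm q"
definition "dist (p::quat) q = norm (p - q)"
definition [code del]:
  "(uniformity :: (quat \<times> quat) filter) = (INF e\<in>{0<..}. principal {(x, y). dist x y < e})"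
definition [code del]:
  "open (U :: quat set) \<longleftrightarrow>
    (\<forall>x\<in>U. eventually (\<lambda>(x', y). x' = x \<longrightarrow> y \<in> U) uniformity)"

instance
proof
  fix x y z :: quat and r :: real and U :: "quat set"
  show "dist x y = norm (x - y)" by (rule dist_quat_def)
  show "sgn x = x /\<^sub>R norm x" by (rule sgn_quat_def)
  show "(uniformity :: (quat \<times> quat) filter) = (INF e\<in>{0<..}. principal {(x, y). dist x y < e})"
    by (rule uniformity_quat_def)
  show "open U \<longleftrightarrow> (\<forall>x\<in>U. eventually (\<lambda>(x', y). x' = x \<longrightarrow> y \<in> U) uniformity)"
    by (rule open_quat_def)
  show "inner x y = inner y x" by (simp add: inner_quat_def mult.commute)
  show "inner (x + y) z = inner x z + inner y z" by (simp add: inner_quat_def algebra_simps)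
  show "inner (r *\<^sub>R x) y = r * inner x y" by (simp add: inner_quat_def algebra_simps)
  show "0 \<le> inner x x" by (simp add: inner_quat_def)
  show "inner x x = 0 \<longleftrightarrow> x = 0"
    unfolding inner_quat_def quat_eq_iff quat_zero_sel
    by (metis (no_types, lifting) add_nonneg_eq_0_iff add_nonneg_nonneg mult_eq_0_iff zero_le_square)
  show "norm x = sqrt (inner x x)" by (rule norm_quat_def)
qed

end

instantiation quat :: real_normed_div_algebra
begin

definition "inverse (q::quat) = Quat (qre q) (- qi q) (- qj q) (- qk q) /\<^sub>R inner q q"
definition "p div (q::quat) = p * inverse q"

instance
proof
  fix p q :: quat
  show "inverse p * p = 1" "p * inverse p = 1" if "p \<noteq> 0"
  proof -
    have "inner p p \<noteq> 0" using that by simp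
    moreover have "Quat (qre p) (- qi p) (- qj p) (- qk p) * p = inner p p *\<^sub>R 1"
      "p * Quat (qre p) (- qi p) (- qj p) (- qk p) = inner p p *\<^sub>R 1"
      by (simp_all add: quat_eq_iff inner_quat_def)
    ultimately show "inverse p * p = 1" "p * inverse p = 1"
      by (simp_all add: inverse_quat_def)
  qed
  show "p div q = p * inverse q" by (rule divide_quat_def)
  show "inverse (0::quat) = 0" by (simp add: inverse_quat_def)
  have "inner (p * q) (p * q) = inner p p * inner q q"
    by (simp add: inner_quat_def algebra_simps)
  then show "norm (p * q) = norm p * norm q"
    by (simp add: norm_quat_def real_sqrt_mult)
qed

end

instantiation quat :: euclidean_space
begin

definition "Basis = {Quat 1 0 0 0, Quat 0 1 0 0, Quat 0 0 1 0, Quat 0 0 0 1}"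

instance
proof
  show "(Basis :: quat set) \<noteq> {}" "finite (Basis :: quat set)"
    by (simp_all add: Basis_quat_def)
next
  fix u v :: quat assume "u \<in> Basis" "v \<in> Basis"
  then show "inner u v = (if u = v then 1 else 0)"
    unfolding Basis_quat_def by (elim insertE emptyE) (simp_all add: inner_quat_def)
next
  fix x :: quat
  show "(\<forall>u\<in>Basis. inner x u = 0) \<longleftrightarrow> x = 0"
    unfolding Basis_quat_def quat_eq_iff[of x] by (simp add: inner_quat_def)
qed

end


section \<open>Slice topology and slice regularity\<close>

definition imag_sphere :: "quat set" where
  "imag_sphere = {q. q\<^sup>2 = - 1}"

abbreviation slice_pt :: "quat \<Rightarrow> real \<Rightarrow> real \<Rightarrow> quat" where
  "slice_pt I x y \<equiv> of_real x + of_real y * I"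

definition slice_plane :: "quat \<Rightarrow> quat set" where
  "slice_plane I = {slice_pt I x y |x y. True}"

definition axially_symmetric :: "quat set \<Rightarrow> bool" where
  "axially_symmetric \<Omega> \<longleftrightarrow>
    (\<forall>x y. \<forall>I\<in>imag_sphere. slice_pt I x y \<in> \<Omega> \<longrightarrow> (\<forall>L\<in>imag_sphere. slice_pt L x y \<in> \<Omega>))"

definition slice_open :: "quat set \<Rightarrow> bool" where
  "slice_open \<Omega> \<longleftrightarrow>
    (\<forall>I\<in>imag_sphere. openin (top_of_set (slice_plane I)) (\<Omega> \<inter> slice_plane I))"

definition slice_topology :: "quat topology" where
  "slice_topology = topology slice_open"

lemma openin_slice_topology: "openin slice_topology = slice_open"
proof -
  have "istopology slice_open"
    unfolding istopology_def
  proof (intro conjI allI impI)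
    fix S T assume "slice_open S" "slice_open T"
    moreover have "(S \<inter> T) \<inter> P = (S \<inter> P) \<inter> (T \<inter> P)" for P :: "quat set" by blast
    ultimately show "slice_open (S \<inter> T)"
      unfolding slice_open_def by (simp only:) (blast intro: openin_Int)
  next
    fix \<K> assume *: "\<forall>K\<in>\<K>. slice_open K"
    show "slice_open (\<Union>\<K>)"
      unfolding slice_open_def
    proof
      fix I assume "I \<in> imag_sphere"
      then have "openin (top_of_set (slice_plane I)) (\<Union>K\<in>\<K>. K \<inter> slice_plane I)"
        using * by (intro openin_Union) (auto simp: slice_open_def)
      moreover have "(\<Union>K\<in>\<K>. K \<inter> slice_plane I) = \<Union>\<K> \<inter> slice_plane I" by blast
      ultimately show "openin (top_of_set (slice_plane I)) (\<Union>\<K> \<inter> slice_plane I)" by simp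
    qed
  qed
  then show ?thesis
    unfolding slice_topology_def by (rule topology_inverse')
qed

abbreviation slice_connected :: "quat set \<Rightarrow> bool" where
  "slice_connected \<equiv> connectedin slice_topology"

text \<open>A function on \<open>\<Omega>\<close> is represented by a total function; since \<open>\<Omega>\<close> is slice-open, the
  derivatives below depend only on its values on \<open>\<Omega>\<close>. The partial derivatives with respect to
  \<open>x\<close> and \<open>y\<close> on the slice of \<open>I\<close> are \<open>fx\<close> and \<open>fy\<close>.\<close>

definition slice_regular_on :: "(quat \<Rightarrow> quat) \<Rightarrow> quat set \<Rightarrow> bool" where
  "slice_regular_on f \<Omega> \<longleftrightarrow> slice_open \<Omega> \<and>
    (\<forall>I\<in>imag_sphere. \<exists>fx fy :: real \<times> real \<Rightarrow> quat.
      continuous_on {(x, y). slice_pt I x y \<in> \<Omega>} fx \<and>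
      continuous_on {(x, y). slice_pt I x y \<in> \<Omega>} fy \<and>
      (\<forall>x y. slice_pt I x y \<in> \<Omega> \<longrightarrow>
        ((\<lambda>t. f (slice_pt I t y)) has_vector_derivative fx (x, y)) (at x) \<and>
        ((\<lambda>t. f (slice_pt I x t)) has_vector_derivative fy (x, y)) (at y) \<and>
        (1 / 2) *\<^sub>R (fx (x, y) + I * fy (x, y)) = 0))"

definition domain_of_slice_regularity :: "quat set \<Rightarrow> bool" where
  "domain_of_slice_regularity \<Omega> \<longleftrightarrow> slice_open \<Omega> \<and>
    \<not> (\<exists>\<Omega>1 \<Omega>2. slice_open \<Omega>1 \<and> slice_open \<Omega>2 \<and>
        \<Omega>1 \<noteq> {} \<and> \<Omega>1 \<subseteq> \<Omega>2 \<inter> \<Omega> \<and>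
        slice_connected \<Omega>2 \<and> \<not> \<Omega>2 \<subseteq> \<Omega> \<and>
        (\<forall>f. slice_regular_on f \<Omega> \<longrightarrow>
          (\<exists>g. slice_regular_on g \<Omega>2 \<and> (\<forall>q\<in>\<Omega>1. f q = g q))))"

end

theory Submission
  imports Defs "HOL-Complex_Analysis.Complex_Analysis"
begin

text \<open>
  Suppose \<open>\<Omega>1\<close>, \<open>\<Omega>2\<close> violate the definition and pick \<open>p = x + yJ\<close> in \<open>\<Omega>2\<close> outside \<open>\<Omega>\<close>. By axial
  symmetry \<open>\<Omega>\<close> misses the whole sphere of points \<open>x + yL\<close>, which is the zero set of
  \<open>P q = (q - x)\<^sup>2 + y\<^sup>2\<close>, so \<open>1 / P\<close> is slice regular on \<open>\<Omega>\<close>. If \<open>g\<close> extends it to \<open>\<Omega>2\<close>, then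
  \<open>P g - 1\<close> vanishes on \<open>\<Omega>1\<close>. As \<open>P\<close> has real coefficients, \<open>P g\<close> is slice regular as well, so the
  identity principle on the slice-connected set \<open>\<Omega>2\<close> yields \<open>P g = 1\<close> there, contradicting
  \<open>P p = 0\<close>.
\<close>

section \<open>Slices as copies of the complex plane\<close>

text \<open>For \<open>I\<close> in \<open>imag_sphere\<close> this is the real-algebra embedding of
  the complex numbers onto the slice, sending \<open>\<i>\<close> to \<open>I\<close>. Preimages
  under it turn statements about slices into one-variable complex analysis.\<close>

definition slice_embed :: "quat \<Rightarrow> complex \<Rightarrow> quat" where
  "slice_embed I z = slice_pt I (Re z) (Im z)"

section \<open>Imaginary units\<close>

lemma imag_sphere_mult: "I \<in> imag_sphere \<Longrightarrow> I * I = - 1"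
  by (simp add: imag_sphere_def power2_eq_square)

lemma imag_sphere_mult_left: "I \<in> imag_sphere \<Longrightarrow> I * (I * q) = - q"
  by (simp add: imag_sphere_mult flip: mult.assoc)

lemma imag_sphere_uminus: "I \<in> imag_sphere \<Longrightarrow> - I \<in> imag_sphere"
  by (simp add: imag_sphere_def)

lemma quat_of_real_sel [simp]:
  "qre (of_real r) = r" "qi (of_real r) = 0" "qj (of_real r) = 0" "qk (of_real r) = 0"
  by (simp_all add: of_real_def)

text \<open>The vector part of \<open>I * I\<close> is twice \<open>qre I\<close> times that of
  \<open>I\<close>. A nonzero real part would thus force \<open>I\<close> to be real with square
  -1.\<close>

lemma imag_sphere_iff:
  "I \<in> imag_sphere \<longleftrightarrow> qre I = 0 \<and> (qi I)\<^sup>2 + (qj I)\<^sup>2 + (qk I)\<^sup>2 = 1"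
proof
  assume "I \<in> imag_sphere"
  then have *: "qre I * qre I - qi I * qi I - qj I * qj I - qk I * qk I = - 1"
      "qre I * qi I = 0" "qre I * qj I = 0" "qre I * qk I = 0"
    by (auto dest!: imag_sphere_mult simp: quat_eq_iff)
  have "qre I = 0"
  proof (rule ccontr)
    assume "qre I \<noteq> 0"
    with * have "qre I * qre I = - 1" by simp
    then show False by (metis neg_0_le_iff_le not_one_le_zero zero_le_square)
  qed
  with * show "qre I = 0 \<and> (qi I)\<^sup>2 + (qj I)\<^sup>2 + (qk I)\<^sup>2 = 1"
    by (simp add: power2_eq_square)
next
  assume "qre I = 0 \<and> (qi I)\<^sup>2 + (qj I)\<^sup>2 + (qk I)\<^sup>2 = 1"
  then show "I \<in> imag_sphere"
    by (simp add: imag_sphere_def quat_eq_iff power2_eq_square)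
qed

lemma inner_imag_sphere:
  assumes "I \<in> imag_sphere"
  shows "inner I I = 1" "inner 1 I = 0" "inner 1 (1::quat) = 1"
  using assms by (simp_all add: imag_sphere_iff inner_quat_def power2_eq_square)

lemma slice_embed_Complex: "slice_embed I (Complex x y) = slice_pt I x y"
  by (simp add: slice_embed_def)

section \<open>The embedding as a homomorphism of real algebras\<close>

lemma slice_embed_mult_eq:
  "slice_embed I z * q = Re z *\<^sub>R q + Im z *\<^sub>R (I * q)"
  by (simp add: slice_embed_def distrib_right scaleR_conv_of_real mult.assoc)

lemma bounded_linear_slice_embed: "bounded_linear (slice_embed I)"
proof -
  have "linear (slice_embed I)"
    by (rule linearI) (simp_all add: slice_embed_def scaleR_conv_of_real algebra_simps)
  then show ?thesis by (simp add: linear_conv_bounded_linear)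
qed

lemma slice_embed_simps [simp]:
  "slice_embed I 0 = 0" "slice_embed I 1 = 1" "slice_embed I (of_real r) = of_real r"
  "slice_embed I (z + w) = slice_embed I z + slice_embed I w"
  "slice_embed I (z - w) = slice_embed I z - slice_embed I w"
  by (simp_all add: slice_embed_def algebra_simps)

lemma slice_embed_mult:
  assumes "I \<in> imag_sphere"
  shows "slice_embed I (z * w) = slice_embed I z * slice_embed I w"
  unfolding slice_embed_mult_eq
  by (simp add: slice_embed_def of_real_def algebra_simps imag_sphere_mult[OF assms])

lemma slice_embed_inverse:
  assumes "I \<in> imag_sphere"
  shows "slice_embed I (inverse z) = inverse (slice_embed I z)"
proof (cases "z = 0")
  case False
  then have "slice_embed I z * slice_embed I (inverse z) = 1"
    by (simp flip: slice_embed_mult[OF assms])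
  then show ?thesis by (rule inverse_unique[symmetric])
qed simp

section \<open>Covering by slices and their overlaps\<close>

lemma slice_embed_surj: obtains I z where "I \<in> imag_sphere" "q = slice_embed I z"
proof (cases "qi q = 0 \<and> qj q = 0 \<and> qk q = 0")
  case True
  \<comment> \<open>A real quaternion lies on every slice, so the choice of unit is
    arbitrary.\<close>
  then have "q = slice_embed (Quat 0 1 0 0) (Complex (qre q) 0)"
    by (simp add: slice_embed_def quat_eq_iff)
  moreover have "Quat 0 1 0 0 \<in> imag_sphere" by (simp add: imag_sphere_iff)
  ultimately show ?thesis using that by blast
next
  case False
  \<comment> \<open>\<open>r\<close> is the length of the vector part; dividing by it yields the
    unit.\<close>
  define r where "r = sqrt ((qi q)\<^sup>2 + (qj q)\<^sup>2 + (qk q)\<^sup>2)"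
  have r2: "r\<^sup>2 = (qi q)\<^sup>2 + (qj q)\<^sup>2 + (qk q)\<^sup>2" by (simp add: r_def)
  have "r \<noteq> 0"
  proof
    assume "r = 0"
    with r2 False show False by (simp add: add_nonneg_eq_0_iff)
  qed
  define I where "I = Quat 0 (qi q / r) (qj q / r) (qk q / r)"
  have "I \<in> imag_sphere"
    using \<open>r \<noteq> 0\<close> by (simp add: I_def imag_sphere_iff power_divide r2 flip: add_divide_distrib)
      (metis r2 zero_eq_power2)
  moreover have "q = slice_embed I (Complex (qre q) r)"
    using \<open>r \<noteq> 0\<close> by (simp add: slice_embed_def I_def quat_eq_iff)
  ultimately show ?thesis using that by blast
qed

text \<open>Slices of \<open>I\<close> and \<open>L\<close> meet only in the real axis unless
  \<open>L\<close> is \<open>I\<close> or \<open>- I\<close>; in the last case they are the same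
  plane with conjugate coordinates. Since units have norm 1, comparing norms of vector parts gives
  the imaginary parts up to sign.\<close>

lemma slice_embed_eq_cases:
  assumes "I \<in> imag_sphere" "L \<in> imag_sphere" "slice_embed I z = slice_embed L w"
  obtains "Im z = 0" "w = z" | "L = I" "w = z" | "L = - I" "w = cnj z"
proof -
  have re: "Re w = Re z" and im: "Im z *\<^sub>R I = Im w *\<^sub>R L"
    using assms by (auto simp: slice_embed_def imag_sphere_iff quat_eq_iff)
  have "inner (Im z *\<^sub>R I) (Im z *\<^sub>R I) = inner (Im w *\<^sub>R L) (Im w *\<^sub>R L)"
    using im by simp
  then have "(Im z)\<^sup>2 = (Im w)\<^sup>2"
    using assms by (simp add: inner_imag_sphere power2_eq_square)
  then consider "Im z = 0" "Im w = 0" | "Im z \<noteq> 0" "Im w = Im z" | "Im z \<noteq> 0" "Im w = - Im z"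
    by (metis power2_eq_iff minus_minus neg_equal_0_iff_equal)
  then show thesis
  proof cases
    case 1 with re show thesis by (intro that(1)) (auto simp: complex_eq_iff)
  next
    case 2 with re im show thesis by (intro that(2)) (auto simp: complex_eq_iff)
  next
    case 3
    with im have "Im z *\<^sub>R L = Im z *\<^sub>R (- I)" by (simp add: minus_equation_iff)
    then have "L = - I" by (rule scaleR_left_imp_eq[OF 3(1)])
    with 3 re show thesis by (intro that(3)) (auto simp: complex_eq_iff)
  qed
qed

lemma slice_embed_uminus: "slice_embed (- I) z = slice_embed I (cnj z)"
  by (simp add: slice_embed_def)

text \<open>\<open>1\<close> and \<open>I\<close> are orthonormal, so inner products with them
  recover the coordinates continuously.\<close>

lemma slice_embed_homeomorphism:
  assumes "I \<in> imag_sphere"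
  shows "homeomorphism UNIV (slice_plane I) (slice_embed I) (\<lambda>q. Complex (inner q 1) (inner q I))"
proof (rule homeomorphismI)
  show "continuous_on UNIV (slice_embed I)"
    by (rule linear_continuous_on[OF bounded_linear_slice_embed])
  show "continuous_on (slice_plane I) (\<lambda>q. Complex (inner q 1) (inner q I))"
    by (intro continuous_intros)
  have left_inverse: "Complex (inner (slice_embed I z) 1) (inner (slice_embed I z) I) = z" for z
    using inner_imag_sphere[OF assms]
    by (simp add: complex_eq_iff slice_embed_def of_real_def inner_add_left inner_commute[of I 1])
  show "slice_embed I ` UNIV \<subseteq> slice_plane I"
    by (auto simp: slice_plane_def slice_embed_def)
  show "Complex (inner (slice_embed I z) 1) (inner (slice_embed I z) I) = z" for z
    by (rule left_inverse)
  show "slice_embed I (Complex (inner q 1) (inner q I)) = q" if "q \<in> slice_plane I" for q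
  proof -
    from that obtain z where "q = slice_embed I z"
      by (auto simp: slice_plane_def simp flip: slice_embed_Complex)
    then show ?thesis by (simp add: left_inverse)
  qed
qed simp

lemma slice_open_iff:
  "slice_open S \<longleftrightarrow> (\<forall>I\<in>imag_sphere. open (slice_embed I -` S))"
  unfolding slice_open_def
proof (intro ball_cong refl)
  fix I assume I: "I \<in> imag_sphere"
  note hom = slice_embed_homeomorphism[OF I]
  have image: "slice_embed I ` (slice_embed I -` S) = S \<inter> slice_plane I"
    using hom by (auto simp: homeomorphism_def)
  show "openin (top_of_set (slice_plane I)) (S \<inter> slice_plane I) \<longleftrightarrow> open (slice_embed I -` S)"
  proof
    assume "openin (top_of_set (slice_plane I)) (S \<inter> slice_plane I)"
    then obtain T where T: "open T" "S \<inter> slice_plane I = slice_plane I \<inter> T"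
      by (auto simp: openin_open)
    have "slice_embed I -` S = slice_embed I -` T"
      using T(2) by (force simp: slice_plane_def slice_embed_def)
    then show "open (slice_embed I -` S)"
      using T(1) linear_continuous_on[OF bounded_linear_slice_embed]
      by (simp add: open_vimage)
  next
    assume "open (slice_embed I -` S)"
    then have "openin (top_of_set UNIV) (slice_embed I -` S)" by simp
    then show "openin (top_of_set (slice_plane I)) (S \<inter> slice_plane I)"
      unfolding image[symmetric] by (rule homeomorphism_imp_open_map[OF hom])
  qed
qed

lemma slice_openD: "slice_open S \<Longrightarrow> I \<in> imag_sphere \<Longrightarrow> open (slice_embed I -` S)"
  by (simp add: slice_open_iff)


section \<open>Slice regularity and holomorphy\<close>

text \<open>Continuity of the partials gives a total real derivative, and the relation between them
  makes this derivative multiplication by \<open>a z\<close>.\<close>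

lemma Cauchy_Riemann_imp_holomorphic:
  fixes F a :: "complex \<Rightarrow> complex"
  assumes "open S" "continuous_on S a"
    and dx: "\<And>z. z \<in> S \<Longrightarrow> ((\<lambda>t. F (Complex t (Im z))) has_vector_derivative a z) (at (Re z))"
    and dy: "\<And>z. z \<in> S \<Longrightarrow>
      ((\<lambda>t. F (Complex (Re z) t)) has_vector_derivative \<i> * a z) (at (Im z))"
  shows "F holomorphic_on S"
proof -
  have "(F has_field_derivative a z) (at z)" if "z \<in> S" for z
  proof -
    obtain e where "e > 0" and e: "ball z e \<subseteq> S"
      using \<open>open S\<close> \<open>z \<in> S\<close> openE by blast
    \<comment> \<open>The product rule for partials needs a rectangle; half the radius on each side
      keeps it inside the disc.\<close>
    define X Y where "X = ball (Re z) (e/2)" and "Y = ball (Im z) (e/2)"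
    have XY: "Complex x y \<in> S" if "x \<in> X" "y \<in> Y" for x y
    proof -
      have "cmod (z - Complex x y) \<le> \<bar>Re z - x\<bar> + \<bar>Im z - y\<bar>"
        using cmod_le[of "z - Complex x y"] by simp
      with that have "Complex x y \<in> ball z e" by (simp add: X_def Y_def dist_norm)
      with e show ?thesis by blast
    qed
    have zXY: "Re z \<in> X" "Im z \<in> Y" using \<open>e > 0\<close> by (simp_all add: X_def Y_def)
    have open_XY: "open (X \<times> Y)" by (simp add: X_def Y_def open_Times)
    have "((\<lambda>(x, y). F (Complex x y)) has_derivative
        (\<lambda>(tx, ty). tx *\<^sub>R a z + blinfun_scaleR_left (\<i> * a (Complex (Re z) (Im z))) ty))
        (at (Re z, Im z) within X \<times> Y)"
    \<comment> \<open>Only the \<open>y\<close> partial must exist and vary continuously, as a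
      bounded linear map; the \<open>x\<close> partial is needed at the point alone.\<close>
    proof (rule has_derivative_partialsI[where fy="\<lambda>x y. blinfun_scaleR_left (\<i> * a (Complex x y))"])
      show "((\<lambda>x. F (Complex x (Im z))) has_derivative (\<lambda>tx. tx *\<^sub>R a z)) (at (Re z) within X)"
        using dx[OF \<open>z \<in> S\<close>] by (simp add: has_vector_derivative_def has_derivative_at_withinI)
      show "((\<lambda>y. F (Complex x y)) has_derivative
          blinfun_apply (blinfun_scaleR_left (\<i> * a (Complex x y)))) (at y within Y)"
        if "x \<in> X" "y \<in> Y" for x y
        using dy[OF XY[OF that]] by (simp add: has_vector_derivative_def has_derivative_at_withinI)
      have "continuous_on (X \<times> Y) (\<lambda>(x, y). a (Complex x y))"
        unfolding split_beta
        by (rule continuous_on_compose2[OF \<open>continuous_on S a\<close>])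
          (auto intro!: continuous_intros XY)
      then have "continuous_on (X \<times> Y) (\<lambda>(x, y). blinfun_scaleR_left (\<i> * a (Complex x y)))"
        unfolding split_beta by (intro continuous_intros)
      then show "continuous (at (Re z, Im z) within X \<times> Y)
          (\<lambda>(x, y). blinfun_scaleR_left (\<i> * a (Complex x y)))"
        using zXY by (simp add: continuous_on_eq_continuous_within)
    qed (use zXY in \<open>simp_all add: Y_def\<close>)
    then have "((\<lambda>(x, y). F (Complex x y)) has_derivative
        (\<lambda>(tx, ty). tx *\<^sub>R a z + ty *\<^sub>R (\<i> * a z))) (at (Re z, Im z))"
      using zXY by (simp add: at_within_open[OF _ open_XY])
    moreover have "((\<lambda>w. (Re w, Im w)) has_derivative (\<lambda>w. (Re w, Im w))) (at z)"
      by (auto intro!: derivative_eq_intros)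
    ultimately have "((\<lambda>w. case (Re w, Im w) of (x, y) \<Rightarrow> F (Complex x y)) has_derivative
        (\<lambda>w. case (Re w, Im w) of (tx, ty) \<Rightarrow> tx *\<^sub>R a z + ty *\<^sub>R (\<i> * a z))) (at z)"
      by (rule has_derivative_compose[rotated])
    moreover have "tx *\<^sub>R a z + ty *\<^sub>R (\<i> * a z) = a z * Complex tx ty" for tx ty
      by (simp add: complex_eq_iff algebra_simps)
    ultimately show ?thesis by (simp add: has_field_derivative_def)
  qed
  then show ?thesis
    using \<open>open S\<close> by (meson holomorphic_onI field_differentiable_def field_differentiable_at_within)
qed

text \<open>A function acting on all slices as one holomorphic \<open>F\<close> has partials
  \<open>F'\<close> and \<open>\<i> * F'\<close> in slice coordinates, so the slice Cauchy-Riemann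
  equation is \<open>\<i> * \<i> = - 1\<close>.\<close>

lemma slice_regular_on_if_slice_preserving:
  assumes "slice_open \<Omega>"
    and hol: "\<And>I. I \<in> imag_sphere \<Longrightarrow> F holomorphic_on slice_embed I -` \<Omega>"
    and f: "\<And>I z. I \<in> imag_sphere \<Longrightarrow> slice_embed I z \<in> \<Omega> \<Longrightarrow>
      f (slice_embed I z) = slice_embed I (F z)"
  shows "slice_regular_on f \<Omega>"
  unfolding slice_regular_on_def
proof (intro conjI ballI)
  show "slice_open \<Omega>" by fact
next
  fix I assume I: "I \<in> imag_sphere"
  define S where "S = slice_embed I -` \<Omega>"
  have "open S" unfolding S_def by (rule slice_openD[OF \<open>slice_open \<Omega>\<close> I])
  have holS: "F holomorphic_on S" unfolding S_def by (rule hol[OF I])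
  have S_iff: "slice_pt I x y \<in> \<Omega> \<longleftrightarrow> Complex x y \<in> S" for x y
    by (simp add: S_def slice_embed_def)
  \<comment> \<open>Chain rule along a path of constant velocity, covering both partials: velocity 1
    gives \<open>fx\<close>, velocity \<open>\<i>\<close> gives \<open>fy\<close>.\<close>
  have deriv: "((\<lambda>t. f (slice_embed I (\<gamma> t))) has_vector_derivative
      slice_embed I (\<gamma>' * deriv F (\<gamma> s))) (at s)"
    if \<gamma>: "\<And>t. (\<gamma> has_vector_derivative \<gamma>') (at t)" and "\<gamma> s \<in> S" for \<gamma> \<gamma>' s
  proof (rule has_vector_derivative_transform_within_open)
    have "(F has_field_derivative deriv F (\<gamma> s)) (at (\<gamma> s))"
      by (rule holomorphic_derivI[OF holS \<open>open S\<close> \<open>\<gamma> s \<in> S\<close>])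
    then have "((F \<circ> \<gamma>) has_vector_derivative \<gamma>' * deriv F (\<gamma> s)) (at s)"
      by (rule field_vector_diff_chain_at[OF \<gamma>])
    then show "((\<lambda>t. slice_embed I ((F \<circ> \<gamma>) t)) has_vector_derivative
        slice_embed I (\<gamma>' * deriv F (\<gamma> s))) (at s)"
      by (rule bounded_linear.has_vector_derivative[OF bounded_linear_slice_embed])
    have "continuous_on UNIV \<gamma>"
      using \<gamma> by (meson continuous_at_imp_continuous_on has_vector_derivative_continuous)
    then show "open (\<gamma> -` S)" using \<open>open S\<close> by (simp add: open_vimage)
  qed (use \<open>\<gamma> s \<in> S\<close> in \<open>auto simp: S_def f[OF I]\<close>)
  have Complex_x: "((\<lambda>t. Complex t y) has_vector_derivative 1) (at x)" for x y
  proof -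
    have "((\<lambda>t. of_real t + \<i> * of_real y) has_vector_derivative 1) (at x)"
      by (auto intro!: derivative_eq_intros)
    then show ?thesis by (simp add: Complex_eq)
  qed
  have Complex_y: "((\<lambda>t. Complex x t) has_vector_derivative \<i>) (at y)" for x y
  proof -
    have "((\<lambda>t. of_real x + \<i> * of_real t) has_vector_derivative \<i>) (at y)"
      by (auto intro!: derivative_eq_intros)
    then show ?thesis by (simp add: Complex_eq)
  qed
  define fx where "fx = (\<lambda>(x, y). slice_embed I (deriv F (Complex x y)))"
  define fy where "fy = (\<lambda>(x, y). slice_embed I (\<i> * deriv F (Complex x y)))"
  have "continuous_on S (deriv F)"
    by (intro holomorphic_on_imp_continuous_on holomorphic_deriv holS \<open>open S\<close>)
  then have cont: "continuous_on {(x, y). slice_pt I x y \<in> \<Omega>} (\<lambda>(x, y). deriv F (Complex x y))"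
    unfolding split_beta
    by (rule continuous_on_compose2) (auto intro!: continuous_intros simp: S_iff)
  show "\<exists>fx fy. continuous_on {(x, y). slice_pt I x y \<in> \<Omega>} fx \<and>
      continuous_on {(x, y). slice_pt I x y \<in> \<Omega>} fy \<and>
      (\<forall>x y. slice_pt I x y \<in> \<Omega> \<longrightarrow>
        ((\<lambda>t. f (slice_pt I t y)) has_vector_derivative fx (x, y)) (at x) \<and>
        ((\<lambda>t. f (slice_pt I x t)) has_vector_derivative fy (x, y)) (at y) \<and>
        (1 / 2) *\<^sub>R (fx (x, y) + I * fy (x, y)) = 0)"
  proof (intro exI conjI allI impI)
    show "continuous_on {(x, y). slice_pt I x y \<in> \<Omega>} fx"
      using cont unfolding fx_def split_beta
      by (intro bounded_linear.continuous_on[OF bounded_linear_slice_embed])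
    show "continuous_on {(x, y). slice_pt I x y \<in> \<Omega>} fy"
      using cont unfolding fy_def split_beta
      by (intro bounded_linear.continuous_on[OF bounded_linear_slice_embed] continuous_intros)
  next
    fix x y assume "slice_pt I x y \<in> \<Omega>"
    then have "Complex x y \<in> S" by (simp add: S_iff)
    show "((\<lambda>t. f (slice_pt I t y)) has_vector_derivative fx (x, y)) (at x)"
      using deriv[OF Complex_x \<open>Complex x y \<in> S\<close>] by (simp add: fx_def slice_embed_Complex)
    show "((\<lambda>t. f (slice_pt I x t)) has_vector_derivative fy (x, y)) (at y)"
      using deriv[OF Complex_y \<open>Complex x y \<in> S\<close>] by (simp add: fy_def slice_embed_Complex)
    have "I * fy (x, y) = slice_embed I \<i> * slice_embed I (\<i> * deriv F (Complex x y))"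
      by (simp add: fy_def slice_embed_def[of I \<i>])
    also have "\<dots> = slice_embed I (\<i> * (\<i> * deriv F (Complex x y)))"
      by (simp only: slice_embed_mult[OF I])
    also have "\<dots> = - fx (x, y)"
      by (simp add: fx_def slice_embed_def)
    finally show "(1 / 2) *\<^sub>R (fx (x, y) + I * fy (x, y)) = 0" by simp
  qed
qed

text \<open>The functionals \<open>slice_coord I c\<close> are complex linear for the left multiplication by the slice
  of \<open>I\<close>; for varying \<open>c\<close> they separate points, and so play the role of the splitting lemma.\<close>

definition slice_coord :: "quat \<Rightarrow> quat \<Rightarrow> quat \<Rightarrow> complex" where
  "slice_coord I c q = Complex (inner q c) (- inner (I * q) c)"

lemma bounded_linear_slice_coord: "bounded_linear (slice_coord I c)"
proof -
  have "linear (slice_coord I c)"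
    by (rule linearI) (simp_all add: slice_coord_def complex_eq_iff algebra_simps inner_simps)
  then show ?thesis by (simp add: linear_conv_bounded_linear)
qed

text \<open>Since \<open>I * (I * q) = - q\<close>, multiplying by \<open>I\<close> exchanges the
  two components as \<open>\<i>\<close> does; this dictates the minus sign in
  \<open>slice_coord\<close>.\<close>

lemma slice_coord_mult:
  "I \<in> imag_sphere \<Longrightarrow> slice_coord I c (slice_embed I z * q) = z * slice_coord I c q"
  by (simp add: slice_embed_mult_eq slice_coord_def complex_eq_iff algebra_simps inner_simps
      imag_sphere_mult_left)

text \<open>For \<open>c = q\<close> the real part is the squared norm of \<open>q\<close>.\<close>

lemma slice_coord_separates:
  assumes "\<And>c. slice_coord I c q = 0"
  shows "q = 0"
  using assms[of q] by (simp add: slice_coord_def complex_eq_iff)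

text \<open>A scalar form of slice regularity, free of partial derivatives, to which theorems on
  complex holomorphic functions apply directly.\<close>

definition slice_holomorphic_on :: "(quat \<Rightarrow> quat) \<Rightarrow> quat set \<Rightarrow> bool" where
  "slice_holomorphic_on f \<Omega> \<longleftrightarrow> (\<forall>I\<in>imag_sphere. \<forall>c.
    (\<lambda>z. slice_coord I c (f (slice_embed I z))) holomorphic_on slice_embed I -` \<Omega>)"

text \<open>Multiplying the slice equation by \<open>I\<close> on the left solves it as
  \<open>fy = I * fx\<close>, which \<open>slice_coord\<close> turns into the complex Cauchy-Riemann
  equation.\<close>

lemma slice_regular_imp_slice_holomorphic:
  assumes "slice_regular_on f \<Omega>"
  shows "slice_holomorphic_on f \<Omega>"
  unfolding slice_holomorphic_on_def
proof (intro ballI allI)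
  fix I c assume I: "I \<in> imag_sphere"
  obtain fx fy where cont: "continuous_on {(x, y). slice_pt I x y \<in> \<Omega>} fx"
    and reg: "\<And>x y. slice_pt I x y \<in> \<Omega> \<Longrightarrow>
        ((\<lambda>t. f (slice_pt I t y)) has_vector_derivative fx (x, y)) (at x) \<and>
        ((\<lambda>t. f (slice_pt I x t)) has_vector_derivative fy (x, y)) (at y) \<and>
        (1 / 2) *\<^sub>R (fx (x, y) + I * fy (x, y)) = 0"
    using assms I unfolding slice_regular_on_def by metis
  let ?l = "slice_coord I c"
  let ?a = "\<lambda>z. ?l (fx (Re z, Im z))"
  show "(\<lambda>z. ?l (f (slice_embed I z))) holomorphic_on slice_embed I -` \<Omega>"
  proof (rule Cauchy_Riemann_imp_holomorphic[where a="?a"])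
    show "open (slice_embed I -` \<Omega>)"
      using assms I by (simp add: slice_regular_on_def slice_openD)
    show "continuous_on (slice_embed I -` \<Omega>) ?a"
      by (intro bounded_linear.continuous_on[OF bounded_linear_slice_coord]
          continuous_on_compose2[OF cont]) (auto intro!: continuous_intros simp: slice_embed_def)
  next
    fix z assume "z \<in> slice_embed I -` \<Omega>"
    then have "slice_pt I (Re z) (Im z) \<in> \<Omega>" by (simp add: slice_embed_def)
    note reg = reg[OF this]
    have "I * (fx (Re z, Im z) + I * fy (Re z, Im z)) = 0" using reg by simp
    then have "fy (Re z, Im z) = slice_embed I \<i> * fx (Re z, Im z)"
      by (simp add: distrib_left imag_sphere_mult_left[OF I] slice_embed_def)
    then have "?l (fy (Re z, Im z)) = \<i> * ?a z" by (simp add: slice_coord_mult[OF I])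
    with bounded_linear.has_vector_derivative[OF bounded_linear_slice_coord, of _ _ _ I c]
    show "((\<lambda>t. ?l (f (slice_embed I (Complex (Re z) t)))) has_vector_derivative \<i> * ?a z)
        (at (Im z))"
      using reg unfolding slice_embed_Complex by metis
    show "((\<lambda>t. ?l (f (slice_embed I (Complex t (Im z))))) has_vector_derivative ?a z)
        (at (Re z))"
      unfolding slice_embed_Complex
      by (rule bounded_linear.has_vector_derivative[OF bounded_linear_slice_coord]) (use reg in blast)
  qed
qed


section \<open>The identity principle\<close>

text \<open>The classical identity theorem holds for each coordinate \<open>slice_coord I c\<close>,
  and the coordinates separate points.\<close>

lemma slice_holomorphic_zero_on_ball:
  assumes "slice_holomorphic_on h \<Omega>" "I \<in> imag_sphere" "ball a r \<subseteq> slice_embed I -` \<Omega>"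
    and "U \<subseteq> ball a r" "\<xi> \<in> ball a r" "\<xi> islimpt U"
    and "\<And>z. z \<in> U \<Longrightarrow> h (slice_embed I z) = 0"
    and "w \<in> ball a r"
  shows "h (slice_embed I w) = 0"
proof (rule slice_coord_separates)
  fix c
  let ?G = "\<lambda>z. slice_coord I c (h (slice_embed I z))"
  have "?G holomorphic_on ball a r"
    using assms(1-3) by (auto simp: slice_holomorphic_on_def intro: holomorphic_on_subset)
  then show "?G w = 0"
    by (rule analytic_continuation[where U=U and \<xi>=\<xi> and S="ball a r"])
      (use assms in \<open>simp_all add: linear_0 bounded_linear.linear[OF bounded_linear_slice_coord]\<close>)
qed

lemma islimpt_of_real_ball:
  assumes "0 < e"
  shows "complex_of_real x islimpt complex_of_real ` ball x e"
proof (rule islimpt_approachable[THEN iffD2], intro allI impI)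
  fix d :: real assume "d > 0"
  define t where "t = x + min d e / 2"
  have "t \<in> ball x e" "t \<noteq> x" "\<bar>t - x\<bar> < d"
    using assms \<open>d > 0\<close> by (auto simp: t_def dist_norm)
  then show "\<exists>z\<in>complex_of_real ` ball x e. z \<noteq> of_real x \<and> dist z (of_real x) < d"
    by (intro bexI[of _ "of_real t"]) (auto simp: dist_of_real dist_real_def)
qed

text \<open>At a real point all slices meet, and a function that is flat along one of them vanishes on a
  real interval, hence is flat along every other one.\<close>

lemma flat_independent_of_slice:
  assumes "slice_open \<Omega>" "slice_holomorphic_on h \<Omega>" "I \<in> imag_sphere" "L \<in> imag_sphere"
    and "slice_embed I z = slice_embed L w" "slice_embed I z \<in> \<Omega>"
    and flat: "\<forall>\<^sub>F u in nhds z. h (slice_embed I u) = 0"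
  shows "\<forall>\<^sub>F u in nhds w. h (slice_embed L u) = 0"
  using assms(3-5)
proof (cases rule: slice_embed_eq_cases)
  case 1
  obtain e where "e > 0" and e: "\<And>u. dist u z < e \<Longrightarrow> h (slice_embed I u) = 0"
    using flat by (auto simp: eventually_nhds_metric)
  obtain d where "d > 0" and d: "ball z d \<subseteq> slice_embed L -` \<Omega>"
    using slice_openD[OF assms(1,4)] assms(5,6) \<open>w = z\<close>
    by (metis open_contains_ball vimageI)
  have z: "z = of_real (Re z)" using \<open>Im z = 0\<close> by (simp add: complex_eq_iff)
  \<comment> \<open>Radius \<open>d\<close> keeps the interval in the disc on the slice of
    \<open>L\<close>, radius \<open>e\<close> where \<open>h\<close> vanishes along the slice of
    \<open>I\<close>; on real points both embeddings agree.\<close>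
  let ?U = "complex_of_real ` ball (Re z) (min d e)"
  have "h (slice_embed L u) = 0" if "u \<in> ball z d" for u
  proof (rule slice_holomorphic_zero_on_ball[OF assms(2,4) d])
    show "?U \<subseteq> ball z d" by (subst z) (auto simp: dist_of_real)
    show "z islimpt ?U"
      using islimpt_of_real_ball[of "min d e" "Re z"] \<open>d > 0\<close> \<open>e > 0\<close> z by simp
    show "h (slice_embed L v) = 0" if v: "v \<in> ?U" for v
    proof -
      from v have "dist v z < e" by (subst z) (auto simp: dist_of_real dist_commute)
      moreover from v have "slice_embed L v = slice_embed I v" by auto
      ultimately show ?thesis by (simp add: e)
    qed
  qed (use that \<open>d > 0\<close> in simp_all)
  then show ?thesis
    using \<open>d > 0\<close> \<open>w = z\<close> by (auto simp: eventually_nhds_metric dist_commute)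
next
  case 2
  with flat show ?thesis by simp
next
  case 3
  \<comment> \<open>Same plane, conjugate coordinate: conjugation carries the neighbourhood
    over.\<close>
  have "filterlim cnj (nhds z) (nhds w)"
    using 3 tendsto_cnj[OF filterlim_ident[of "nhds w"]] by simp
  with flat show ?thesis
    unfolding 3(1) slice_embed_uminus by (rule eventually_compose_filterlim)
qed

text \<open>The points near which \<open>h\<close> vanishes along a slice form a slice-open set
  \<open>A\<close> containing \<open>V\<close>. The identity theorem on discs makes
  \<open>\<Omega> - A\<close> slice-open as well, so slice-connectedness leaves only
  \<open>A\<close>.\<close>

theorem slice_identity_principle:
  assumes "slice_open \<Omega>" "slice_connected \<Omega>" "slice_holomorphic_on h \<Omega>"
    and "slice_open V" "V \<noteq> {}" "V \<subseteq> \<Omega>" and zero: "\<And>q. q \<in> V \<Longrightarrow> h q = 0"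
    and "q \<in> \<Omega>"
  shows "h q = 0"
proof -
  define flat where "flat I z \<longleftrightarrow> (\<forall>\<^sub>F u in nhds z. h (slice_embed I u) = 0)" for I z
  define A where "A = {q\<in>\<Omega>. \<exists>I\<in>imag_sphere. \<exists>z. q = slice_embed I z \<and> flat I z}"
  \<comment> \<open>One flat representation of a point makes all its representations flat, so
    \<open>A\<close> can be tested on any slice through the point.\<close>
  have A_iff: "slice_embed I z \<in> A \<longleftrightarrow> slice_embed I z \<in> \<Omega> \<and> flat I z" if "I \<in> imag_sphere" for I z
  proof
    assume "slice_embed I z \<in> A"
    then obtain L w where "L \<in> imag_sphere" "slice_embed L w = slice_embed I z" "flat L w"
      and "slice_embed I z \<in> \<Omega>" by (auto simp: A_def)
    then show "slice_embed I z \<in> \<Omega> \<and> flat I z"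
      using flat_independent_of_slice[OF assms(1,3), of L I w z] that by (simp add: flat_def)
  qed (use that in \<open>auto simp: A_def\<close>)
  have "slice_open A"
    unfolding slice_open_iff
  proof
    fix I assume I: "I \<in> imag_sphere"
    have "\<forall>\<^sub>F u in nhds z. slice_embed I u \<in> A" if "slice_embed I z \<in> A" for z
    proof -
      have "\<forall>\<^sub>F u in nhds z. u \<in> slice_embed I -` \<Omega>"
        using that slice_openD[OF assms(1) I] by (intro eventually_nhds_in_open) (auto simp: A_def)
      moreover have "\<forall>\<^sub>F u in nhds z. flat I u"
        using that by (simp add: A_iff[OF I] flat_def eventually_eventually)
      ultimately show ?thesis by eventually_elim (simp add: A_iff[OF I])
    qed
    then show "open (slice_embed I -` A)"
      by (subst open_subopen) (auto simp: eventually_nhds subset_eq)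
  qed
  moreover have "slice_open (\<Omega> - A)"
    unfolding slice_open_iff
  proof
    fix I assume I: "I \<in> imag_sphere"
    have "\<exists>d>0. ball z d \<subseteq> slice_embed I -` (\<Omega> - A)" if z: "slice_embed I z \<in> \<Omega> - A" for z
    proof -
      obtain d where "d > 0" and d: "ball z d \<subseteq> slice_embed I -` \<Omega>"
        using slice_openD[OF assms(1) I] z by (metis DiffD1 open_contains_ball vimageI)
      \<comment> \<open>A flat point \<open>w\<close> anywhere in the disc would make
        \<open>h\<close> vanish on the whole disc, hence make its centre \<open>z\<close>
        flat.\<close>
      have "slice_embed I w \<notin> A" if w: "w \<in> ball z d" for w
      proof
        assume "slice_embed I w \<in> A"
        then obtain e where "e > 0" and e: "\<And>u. dist u w < e \<Longrightarrow> h (slice_embed I u) = 0"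
          by (auto simp: A_iff[OF I] flat_def eventually_nhds_metric)
        have "h (slice_embed I u) = 0" if "u \<in> ball z d" for u
        proof (rule slice_holomorphic_zero_on_ball[OF assms(3) I d])
          have "w islimpt ball z d" using w by (intro open_imp_islimpt open_ball)
          then show "w islimpt ball z d \<inter> ball w e"
            using \<open>e > 0\<close> eventually_at_in_open'[OF open_ball centre_in_ball[THEN iffD2], of e w]
            by (intro islimpt_Int_eventually) auto
        qed (use that w e in \<open>auto simp: dist_commute\<close>)
        then have "flat I z"
          using \<open>d > 0\<close> by (auto simp: flat_def eventually_nhds_metric dist_commute)
        with z show False by (simp add: A_iff[OF I])
      qed
      with \<open>d > 0\<close> d show ?thesis by blast
    qed
    then show "open (slice_embed I -` (\<Omega> - A))" by (auto simp: open_contains_ball)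
  qed
  moreover have "A \<inter> \<Omega> \<noteq> {}"
  proof -
    obtain v where "v \<in> V" using \<open>V \<noteq> {}\<close> by blast
    obtain I z where I: "I \<in> imag_sphere" and v: "v = slice_embed I z" by (rule slice_embed_surj)
    have "\<forall>\<^sub>F u in nhds z. u \<in> slice_embed I -` V"
      using slice_openD[OF assms(4) I] \<open>v \<in> V\<close> v by (intro eventually_nhds_in_open) auto
    then have "flat I z" unfolding flat_def by eventually_elim (simp add: zero)
    then have "v \<in> A" using I v \<open>v \<in> V\<close> \<open>V \<subseteq> \<Omega>\<close> by (auto simp: A_iff)
    then show ?thesis by (auto simp: A_def)
  qed
  ultimately have "(\<Omega> - A) \<inter> \<Omega> = {}"
    using assms(2) connectedinD[of slice_topology \<Omega> A "\<Omega> - A"]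
    unfolding openin_slice_topology by blast
  with \<open>q \<in> \<Omega>\<close> have "q \<in> A" by blast
  then show ?thesis by (auto simp: A_def flat_def dest: eventually_nhds_x_imp_x)
qed


section \<open>Axially symmetric sets\<close>

theorem proposition9p5:
  fixes \<Omega> :: "quat set"
  assumes "slice_open \<Omega>" and "axially_symmetric \<Omega>"
  shows "domain_of_slice_regularity \<Omega>"
  unfolding domain_of_slice_regularity_def
proof (intro conjI notI)
  show "slice_open \<Omega>" by fact
next
  assume "\<exists>\<Omega>1 \<Omega>2. slice_open \<Omega>1 \<and> slice_open \<Omega>2 \<and>
        \<Omega>1 \<noteq> {} \<and> \<Omega>1 \<subseteq> \<Omega>2 \<inter> \<Omega> \<and>
        slice_connected \<Omega>2 \<and> \<not> \<Omega>2 \<subseteq> \<Omega> \<and>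
        (\<forall>f. slice_regular_on f \<Omega> \<longrightarrow>
          (\<exists>g. slice_regular_on g \<Omega>2 \<and> (\<forall>q\<in>\<Omega>1. f q = g q)))"
  then obtain \<Omega>1 \<Omega>2 where \<Omega>1: "slice_open \<Omega>1" "\<Omega>1 \<noteq> {}" "\<Omega>1 \<subseteq> \<Omega>2" "\<Omega>1 \<subseteq> \<Omega>"
    and \<Omega>2: "slice_open \<Omega>2" "slice_connected \<Omega>2" "\<not> \<Omega>2 \<subseteq> \<Omega>"
    and ext: "\<And>f. slice_regular_on f \<Omega> \<Longrightarrow> \<exists>g. slice_regular_on g \<Omega>2 \<and> (\<forall>q\<in>\<Omega>1. f q = g q)"
    by auto
  obtain p where p: "p \<in> \<Omega>2" "p \<notin> \<Omega>" using \<Omega>2(3) by blast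
  obtain J \<zeta> where J: "J \<in> imag_sphere" and p_eq: "p = slice_embed J \<zeta>" by (rule slice_embed_surj)
  define x y where "x = Re \<zeta>" and "y = Im \<zeta>"
  define P :: "quat \<Rightarrow> quat" where "P q = (q - of_real x)\<^sup>2 + of_real (y\<^sup>2)" for q
  \<comment> \<open>The same real polynomial on the complex plane; real coefficients let it commute
    with every \<open>slice_embed I\<close>.\<close>
  define Q :: "complex \<Rightarrow> complex" where "Q z = (z - of_real x)\<^sup>2 + of_real (y\<^sup>2)" for z
  have P_embed: "P (slice_embed I z) = slice_embed I (Q z)" if "I \<in> imag_sphere" for I z
    unfolding P_def Q_def power2_eq_square[of "_ - _"]
    by (simp add: slice_embed_mult[OF that] del: of_real_power)
  have Q_zero: "Q z = 0 \<longleftrightarrow> z = Complex x y \<or> z = Complex x (- y)" for z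
  proof -
    have "Q z = (z - Complex x y) * (z - Complex x (- y))"
      by (simp add: Q_def complex_eq_iff power2_eq_square algebra_simps)
    then show ?thesis by simp
  qed
  have Q_nonzero: "Q z \<noteq> 0" if I: "I \<in> imag_sphere" and z: "slice_embed I z \<in> \<Omega>" for I z
  proof
    assume "Q z = 0"
    \<comment> \<open>The conjugate root in the slice of \<open>I\<close> is the point
      \<open>x + y * (- I)\<close>, so either root lies on the sphere of \<open>p\<close>.\<close>
    then have "slice_pt I x y \<in> \<Omega> \<or> slice_pt (- I) x y \<in> \<Omega>"
      using z by (auto simp: Q_zero slice_embed_def)
    then have "slice_pt J x y \<in> \<Omega>"
      using assms(2) I J imag_sphere_uminus[OF I] unfolding axially_symmetric_def by blast
    with p(2) show False by (simp add: p_eq slice_embed_def x_def y_def)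
  qed
  have "slice_regular_on (\<lambda>q. inverse (P q)) \<Omega>"
  proof (rule slice_regular_on_if_slice_preserving[OF assms(1), where F="\<lambda>z. inverse (Q z)"])
    show "(\<lambda>z. inverse (Q z)) holomorphic_on slice_embed I -` \<Omega>" if "I \<in> imag_sphere" for I
      using Q_nonzero[OF that] unfolding Q_def by (intro holomorphic_intros) auto
  qed (simp add: P_embed slice_embed_inverse)
  from ext[OF this] obtain g where g: "slice_regular_on g \<Omega>2"
    and g_eq: "\<And>q. q \<in> \<Omega>1 \<Longrightarrow> inverse (P q) = g q" by blast
  have "P p * g p - 1 = 0"
  proof (rule slice_identity_principle[OF \<Omega>2(1,2) _ \<Omega>1(1-3),
        where h="\<lambda>q. P q * g q - 1" and q=p])
    show "slice_holomorphic_on (\<lambda>q. P q * g q - 1) \<Omega>2"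
      unfolding slice_holomorphic_on_def
    proof (intro ballI allI)
      fix I c assume I: "I \<in> imag_sphere"
      \<comment> \<open>On the slice of \<open>I\<close> the left factor \<open>P\<close> takes
        values in that slice, so \<open>slice_coord\<close> pulls it out as the holomorphic factor
        \<open>Q\<close>.\<close>
      have "(\<lambda>z. Q z * slice_coord I c (g (slice_embed I z)) - slice_coord I c 1)
          holomorphic_on slice_embed I -` \<Omega>2"
        using slice_regular_imp_slice_holomorphic[OF g] I
        unfolding Q_def slice_holomorphic_on_def by (intro holomorphic_intros) auto
      then show "(\<lambda>z. slice_coord I c (P (slice_embed I z) * g (slice_embed I z) - 1))
          holomorphic_on slice_embed I -` \<Omega>2"
        by (simp add: P_embed[OF I] slice_coord_mult[OF I]
            linear_diff[OF bounded_linear.linear[OF bounded_linear_slice_coord]])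
    qed
    fix q assume "q \<in> \<Omega>1"
    obtain I z where I: "I \<in> imag_sphere" and q: "q = slice_embed I z" by (rule slice_embed_surj)
    \<comment> \<open>As \<open>inverse 0 = 0\<close>, cancelling needs \<open>P\<close> to be
      nonzero here; this holds because \<open>\<Omega>1\<close> lies in
      \<open>\<Omega>\<close>.\<close>
    have "Q z \<noteq> 0" using Q_nonzero[OF I] \<open>q \<in> \<Omega>1\<close> \<Omega>1(4) q by blast
    then have "P q * inverse (P q) = 1"
      by (simp add: q P_embed[OF I] flip: slice_embed_inverse[OF I] slice_embed_mult[OF I])
    then show "P q * g q - 1 = 0" by (simp flip: g_eq[OF \<open>q \<in> \<Omega>1\<close>])
  qed fact
  moreover have "Q \<zeta> = 0" by (simp add: Q_zero x_def y_def)
  then have "P p = 0" by (simp add: p_eq P_embed[OF J])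
  ultimately show False by simp
qed

end
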